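(* Let $f=f_1+\mathrm{i}f_2$ be the generating function of the Toeplitz matrix $T_n(f)$, where $f_1$ and $f_2$ are continuous, $2\pi$-periodic and bounded real functions, $f_1$ is positive and even, and $f_2$ is odd. For given degrees, let $p=p_1+\mathrm{i}p_2$, where $p_1$ is the even trigonometric polynomial of best uniform approximation of $f_1$, with maximum error $\epsilon_1$, and $p_2$ is the odd trigonometric polynomial of best uniform approximation of $f_2$, with maximum error $\epsilon_2$. Then for any given $\epsilon>0$ there exist such $p_1$ and $p_2$, of suitable degrees, such that the singular values of the preconditioned matrix $T_n^{-1}(p)T_n(f)$ have a general cluster in the interval $[1-M\epsilon,1+M\epsilon]$, where $$M=\max_{-\pi\le x\le\pi}\left(\frac{1}{p_1^2(x)+p_2^2(x)}\right)^{\frac12}.$$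
   Context: For an integrable $2\pi$-periodic function $h$, $T_n(h)$ is the $n\times n$ Toeplitz matrix with $(j,k)$ entry $\frac{1}{2\pi}\int_{-\pi}^{\pi}h(x)\mathrm{e}^{-\mathrm{i}(j-k)x}\,\mathrm{d}x$, and $T_n^{-1}(h)=(T_n(h))^{-1}$. Best uniform approximation is with respect to the sup norm on $[-\pi,\pi]$ among even (respectively odd) real trigonometric polynomials of a prescribed degree; the maximum errors are $\epsilon_i=\max_{[-\pi,\pi]}|f_i-p_i|$. General cluster: for a sequence $\{A_n\}$, $A_n\in\mathbb{C}^{n\times n}$, and a set $\Phi$, let $\gamma_n(\delta)$ be the number of singular values of $A_n$ outside the $\delta$-extension of $\Phi$ (the union of $\Phi$ with all $\delta$-balls centred at its points). $\Phi$ is a general cluster if $\lim_{n\to\infty}\gamma_n(\delta)/n=0$ for every $\delta>0$. *)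

theory Defs
  imports
    "HOL-Analysis.Analysis"
    "Jordan_Normal_Form.Schur_Decomposition"
begin

definition toeplitz :: "(real \<Rightarrow> complex) \<Rightarrow> nat \<Rightarrow> complex mat" where
  "toeplitz h n = Matrix.mat n n (\<lambda>(j, k).
     1 / (2 * complex_of_real pi) *
     (LBINT x:{-pi..pi}. h x * exp (- \<i> * of_int (int j - int k) * complex_of_real x)))"

definition sup_dist :: "(real \<Rightarrow> real) \<Rightarrow> (real \<Rightarrow> real) \<Rightarrow> real" where
  "sup_dist f q = (SUP x\<in>{-pi..pi}. \<bar>f x - q x\<bar>)"

text \<open>Degree \<open>d\<close> is read as degree at most \<open>d\<close>.\<close>

definition trig_polys :: "nat \<Rightarrow> (real \<Rightarrow> real) set" where
  "trig_polys d = {q. \<exists>a b :: nat \<Rightarrow> real.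
     \<forall>x. q x = (\<Sum>k\<le>d. a k * cos (real k * x) + b k * sin (real k * x))}"

definition even_fun :: "(real \<Rightarrow> real) \<Rightarrow> bool" where
  "even_fun g \<longleftrightarrow> (\<forall>x. g (- x) = g x)"

definition odd_fun :: "(real \<Rightarrow> real) \<Rightarrow> bool" where
  "odd_fun g \<longleftrightarrow> (\<forall>x. g (- x) = - g x)"

definition even_trig_polys :: "nat \<Rightarrow> (real \<Rightarrow> real) set" where
  "even_trig_polys d = {q \<in> trig_polys d. even_fun q}"

definition odd_trig_polys :: "nat \<Rightarrow> (real \<Rightarrow> real) set" where
  "odd_trig_polys d = {q \<in> trig_polys d. odd_fun q}"

definition best_approx :: "(real \<Rightarrow> real) set \<Rightarrow> (real \<Rightarrow> real) \<Rightarrow> (real \<Rightarrow> real) \<Rightarrow> bool" where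
  "best_approx S f q \<longleftrightarrow> q \<in> S \<and> (\<forall>r\<in>S. sup_dist f q \<le> sup_dist f r)"

text \<open>Singular values with multiplicity: square roots of the (real, nonnegative) eigenvalues
  of \<open>A\<^sup>* A\<close>, counted with algebraic multiplicity.\<close>

definition singular_values :: "complex mat \<Rightarrow> real multiset" where
  "singular_values A =
     image_mset (\<lambda>z. sqrt (Re z)) (proots (char_poly (mat_adjoint A * A)))"

definition extension :: "real \<Rightarrow> real set \<Rightarrow> real set" where
  "extension \<delta> \<Phi> = \<Phi> \<union> (\<Union>c\<in>\<Phi>. ball c \<delta>)"

definition outliers :: "complex mat \<Rightarrow> real set \<Rightarrow> real \<Rightarrow> nat" where
  "outliers A \<Phi> \<delta> = size (filter_mset (\<lambda>s. s \<notin> extension \<delta> \<Phi>) (singular_values A))"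

text \<open>Meant for sequences in which \<open>A n\<close> is an \<open>n \<times> n\<close> matrix.\<close>

definition general_cluster :: "(nat \<Rightarrow> complex mat) \<Rightarrow> real set \<Rightarrow> bool" where
  "general_cluster A \<Phi> \<longleftrightarrow>
     (\<forall>\<delta>>0. (\<lambda>n. real (outliers (A n) \<Phi> \<delta>) / real n) \<longlonglongrightarrow> 0)"

end

theory Submission
  imports Defs "HOL-Library.Periodic_Fun"
begin

text \<open>
  The interval \<open>[1 - M\<epsilon>, 1 + M\<epsilon>]\<close> catches all singular values, for every \<open>n\<close>, once \<open>p\<close> is close
  enough to \<open>f\<close>; so the number of outliers is zero and no asymptotic argument is called for.

  Let \<open>m\<close> be the minimum of \<open>f\<^sub>1\<close>, which is positive, and put \<open>c = m / 2\<close>. The sesquilinear form of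
  \<open>T\<^sub>n(h)\<close> is an integral against \<open>h\<close> (\<open>toeplitz_form\<close>). Hence \<open>p\<^sub>1 \<ge> c\<close> makes the Hermitian part of
  \<open>T\<^sub>n(p)\<close> at least \<open>c\<close>, so that \<open>T\<^sub>n(p)\<close> is invertible with inverse of norm at most \<open>1 / c\<close>, while
  \<open>T\<^sub>n(f - p)\<close> has norm at most the sup norm of \<open>f - p\<close>. Therefore
  \<open>T\<^sub>n(p)\<^sup>-\<^sup>1 T\<^sub>n(f) = I + T\<^sub>n(p)\<^sup>-\<^sup>1 T\<^sub>n(f - p)\<close> differs from the identity by a matrix of norm at most
  \<open>\<parallel>f - p\<parallel> / c\<close> (\<open>toeplitz_solution_bound\<close>), and each of its singular values is within this distance
  of 1 (\<open>preconditioned_singular_values\<close>).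

  It remains to make \<open>\<parallel>f - p\<parallel> / c \<le> M\<epsilon>\<close>, where \<open>M\<close> itself depends on \<open>p\<close>. But \<open>M\<close> is bounded below
  independently of \<open>p\<close>: since \<open>p\<^sub>2\<close> is odd, \<open>M \<ge> 1 / p\<^sub>1(0)\<close>, and \<open>p\<^sub>1(0) \<le> f\<^sub>1(0) + c\<close> as soon as the
  errors are at most \<open>c\<close>. Best approximations with errors as small as desired exist
  (\<open>best_even_trig_approx\<close>, \<open>best_odd_trig_approx\<close>): finite-dimensional spaces are proximinal
  (\<open>best_approximation_in_span\<close>), and trigonometric polynomials are dense
  (\<open>trigonometric_Weierstrass\<close>).
\<close>

(* Leaves "$" to the index notation of vectors whose dimension is a number. *)
unbundle no vec_syntax

section \<open>Existence of best approximations\<close>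

text \<open>Finite-dimensional subspaces of a normed space are proximinal. Induction on the number of
  generators keeps compactness one-dimensional and needs no linear independence: let \<open>D g\<close> be
  the distance from \<open>g\<close> to the span of the first \<open>n\<close> generators, which is attained by the
  induction hypothesis. If \<open>D (v n) = 0\<close> the new generator adds nothing. Otherwise
  \<open>c \<mapsto> D (f - c v\<^sub>n)\<close> is Lipschitz and grows at least like \<open>\<bar>c\<bar> D (v n)\<close>, so it attains
  its minimum on a bounded interval.\<close>

lemma best_approximation_in_span:
  fixes v :: "nat \<Rightarrow> 'a::real_normed_vector"
  shows "\<exists>a. \<forall>b. norm (f - (\<Sum>k<n. a k *\<^sub>R v k)) \<le> norm (f - (\<Sum>k<n. b k *\<^sub>R v k))"
proof (induction n arbitrary: f)
  case 0
  show ?case by simp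
next
  case (Suc n)
  define S where "S a = (\<Sum>k<n. a k *\<^sub>R v k)" for a
  obtain best where best: "norm (g - S (best g)) \<le> norm (g - S b)" for g b
    using Suc.IH unfolding S_def by metis
  define D where "D g = norm (g - S (best g))" for g
  have D_le: "D g \<le> norm (g - S b)" for g b
    unfolding D_def by (rule best)
  have S_add: "S a + S b = S (\<lambda>k. a k + b k)" for a b
    by (simp add: S_def scaleR_add_left sum.distrib)
  have S_scale: "c *\<^sub>R S a = S (\<lambda>k. c * a k)" for a c
    by (simp add: S_def scaleR_sum_right)
  have S_cong: "S a = S b" if "\<And>k. k < n \<Longrightarrow> a k = b k" for a b
    unfolding S_def using that by (intro sum.cong) auto
  have S_Suc: "(\<Sum>k<Suc n. a k *\<^sub>R v k) = S a + a n *\<^sub>R v n" for a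
    by (simp add: S_def)
  have S_upd: "S (a(n := c)) = S a" for a c
    by (rule S_cong) auto
  show ?case
  proof (cases "D (v n) = 0")
    case True
    then have vn: "v n = S (best (v n))" by (simp add: D_def)
    have "norm (f - (S (best f))) \<le> norm (f - (S b + b n *\<^sub>R v n))" for b
      by (subst vn) (simp add: S_scale S_add best)
    then have "norm (f - (S ((best f)(n := 0)) + ((best f)(n := 0)) n *\<^sub>R v n))
        \<le> norm (f - (S b + b n *\<^sub>R v n))" for b
      unfolding S_upd by simp
    then show ?thesis unfolding S_Suc by blast
  next
    case False
    then have Dpos: "D (v n) > 0" by (simp add: D_def)
    have Lip: "D g \<le> D g' + norm (g - g')" for g g'
    proof -
      have "D g \<le> norm (g - S (best g'))" by (rule D_le)
      also have "\<dots> \<le> norm (g' - S (best g')) + norm (g - g')"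
        using norm_triangle_ineq[of "g' - S (best g')" "g - g'"] by simp
      finally show ?thesis by (simp add: D_def)
    qed
    define h where "h c = D (f - c *\<^sub>R v n)" for c
    have h_Lip: "\<bar>h c - h c'\<bar> \<le> \<bar>c - c'\<bar> * norm (v n)" for c c'
    proof -
      have "norm ((f - c *\<^sub>R v n) - (f - c' *\<^sub>R v n)) = \<bar>c - c'\<bar> * norm (v n)" for c c'
      proof -
        have "(f - c *\<^sub>R v n) - (f - c' *\<^sub>R v n) = (c' - c) *\<^sub>R v n"
          by (simp add: scaleR_diff_left)
        then show ?thesis by (simp only: norm_scaleR real_norm_def abs_minus_commute)
      qed
      from this[of c c'] this[of c' c] show ?thesis
        using Lip[of "f - c *\<^sub>R v n" "f - c' *\<^sub>R v n"] Lip[of "f - c' *\<^sub>R v n" "f - c *\<^sub>R v n"]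
        unfolding h_def abs_minus_commute[of c' c] by linarith
    qed
    have h_cont: "continuous_on T h" for T
    proof (rule continuous_onI)
      fix c e :: real
      assume e: "e > 0"
      show "\<exists>d>0. \<forall>c'\<in>T. dist c' c < d \<longrightarrow> dist (h c') (h c) \<le> e"
      proof (intro exI[of _ "e / (norm (v n) + 1)"] conjI ballI impI)
        show "0 < e / (norm (v n) + 1)" using e by (simp add: add_nonneg_pos)
        fix c' assume "dist c' c < e / (norm (v n) + 1)"
        then have "\<bar>c' - c\<bar> * (norm (v n) + 1) < e"
          by (simp add: dist_real_def pos_less_divide_eq add_nonneg_pos)
        then have "\<bar>c' - c\<bar> * norm (v n) \<le> e"
          by (simp add: distrib_left)
        then show "dist (h c') (h c) \<le> e"
          using h_Lip[of c' c] by (simp add: dist_real_def)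
      qed
    qed
    \<comment> \<open>Divide by \<open>c\<close>: the error at \<open>c\<close> is \<open>\<bar>c\<bar>\<close> times a distance from \<open>v n\<close> to the old span, up to \<open>norm f\<close>.\<close>
    have h_lower: "\<bar>c\<bar> * D (v n) - norm f \<le> h c" for c
    proof (cases "c = 0")
      case True
      moreover have "0 \<le> h c" by (simp add: h_def D_def)
      moreover have "0 \<le> norm f" by simp
      ultimately show ?thesis by (simp del: norm_ge_zero)
    next
      case False
      let ?a = "best (f - c *\<^sub>R v n)"
      have "c *\<^sub>R (v n - S (\<lambda>k. - inverse c * ?a k)) = c *\<^sub>R v n + S ?a"
      proof -
        have "c *\<^sub>R S (\<lambda>k. - inverse c * ?a k) = S (\<lambda>k. - ?a k)"
          unfolding S_scale using False by (intro S_cong) simp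
        also have "\<dots> = - S ?a" by (simp add: S_def sum_negf)
        finally show ?thesis by (simp add: scaleR_diff_right)
      qed
      then have "\<bar>c\<bar> * norm (v n - S (\<lambda>k. - inverse c * ?a k)) = norm (c *\<^sub>R v n + S ?a)"
        by (simp only: norm_scaleR[symmetric])
      moreover have "\<bar>c\<bar> * D (v n) \<le> \<bar>c\<bar> * norm (v n - S (\<lambda>k. - inverse c * ?a k))"
        by (intro mult_left_mono D_le) auto
      moreover have "norm (c *\<^sub>R v n + S ?a) \<le> norm f + norm (f - (c *\<^sub>R v n + S ?a))"
        by (subst norm_minus_commute) (rule norm_triangle_sub)
      ultimately show ?thesis by (simp add: h_def D_def diff_diff_eq)
    qed
    \<comment> \<open>Beyond \<open>R\<close> the lower bound exceeds \<open>norm f\<close>, which is already reached at \<open>c = 0\<close>.\<close>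
    define R where "R = 2 * norm f / D (v n)"
    have R0: "R \<ge> 0" using Dpos by (simp add: R_def)
    obtain c where c: "c \<in> {-R..R}" "\<And>c'. c' \<in> {-R..R} \<Longrightarrow> h c \<le> h c'"
      using continuous_attains_inf[of "{-R..R}" h] h_cont R0 by auto
    have c_min: "h c \<le> h c'" for c'
    proof (cases "c' \<in> {-R..R}")
      case False
      then have "\<bar>c'\<bar> > R" by auto
      then have "\<bar>c'\<bar> * D (v n) \<ge> R * D (v n)" using Dpos by (intro mult_right_mono) auto
      then have "norm f \<le> h c'" using h_lower[of c'] Dpos by (simp add: R_def)
      moreover have "h 0 \<le> norm f"
        using D_le[of f "\<lambda>_. 0"] by (simp add: h_def S_def)
      moreover have "h c \<le> h 0" using c R0 by auto
      ultimately show ?thesis by linarith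
    qed (use c in auto)
    define a where "a = (best (f - c *\<^sub>R v n))(n := c)"
    have "norm (f - (S a + a n *\<^sub>R v n)) \<le> norm (f - (S b + b n *\<^sub>R v n))" for b
    proof -
      have "norm (f - (S a + a n *\<^sub>R v n)) = h c"
        by (simp add: a_def S_upd h_def D_def algebra_simps)
      also have "\<dots> \<le> h (b n)" by (rule c_min)
      also have "\<dots> \<le> norm (f - b n *\<^sub>R v n - S b)"
        unfolding h_def by (rule D_le)
      finally show ?thesis by (simp add: algebra_simps)
    qed
    then show ?thesis unfolding S_Suc by blast
  qed
qed

text \<open>The sup norm over \<open>[-\<pi>, \<pi>]\<close> becomes the norm of a bounded continuous function on the line after
  composing with the retraction \<open>cl\<close> of the line onto that interval; then proximinality applies.\<close>

lemma best_approx_exists: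
  fixes f :: "real \<Rightarrow> real" and \<phi> :: "nat \<Rightarrow> real \<Rightarrow> real"
  assumes f: "continuous_on UNIV f" and \<phi>: "\<And>k. continuous_on UNIV (\<phi> k)"
  shows "\<exists>q. best_approx {q. \<exists>a. \<forall>x. q x = (\<Sum>k<n. a k * \<phi> k x)} f q"
proof -
  define cl where "cl x = max (-pi) (min pi x)" for x :: real
  have cl_range: "range cl = {-pi..pi}"
  proof
    show "{-pi..pi} \<subseteq> range cl"
    proof
      fix x assume "x \<in> {-pi..pi}"
      then have "x = cl x" by (auto simp: cl_def)
      then show "x \<in> range cl" by blast
    qed
  qed (auto simp: cl_def)
  have cl_cont: "continuous_on UNIV cl"
    unfolding cl_def by (intro continuous_intros)
  have in_bc: "(\<lambda>x. g (cl x)) \<in> bcontfun" if "continuous_on UNIV g" for g :: "real \<Rightarrow> real"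
  proof -
    have "compact (g ` {-pi..pi})"
      using that by (intro compact_continuous_image continuous_on_subset[OF that]) auto
    then have "bounded (g ` range cl)"
      by (simp add: cl_range compact_imp_bounded)
    moreover have "continuous_on UNIV (\<lambda>x. g (cl x))"
      by (rule continuous_on_compose2[OF that cl_cont]) auto
    ultimately show ?thesis by (simp add: bcontfun_def image_image)
  qed
  define B where "B g = Bcontfun (\<lambda>x. g (cl x))" for g :: "real \<Rightarrow> real"
  have B_apply: "apply_bcontfun (B g) x = g (cl x)" if "continuous_on UNIV g" for g x
    unfolding B_def using Bcontfun_inverse[OF in_bc[OF that]] by simp
  have sum_apply: "apply_bcontfun (\<Sum>k<m. a k *\<^sub>R B (\<phi> k)) x = (\<Sum>k<m. a k * \<phi> k (cl x))" for m a x
    by (induction m) (simp_all add: B_apply[OF \<phi>])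
  have key: "sup_dist f (\<lambda>x. \<Sum>k<n. a k * \<phi> k x) = norm (B f - (\<Sum>k<n. a k *\<^sub>R B (\<phi> k)))" for a
  proof -
    have "norm (B f - (\<Sum>k<n. a k *\<^sub>R B (\<phi> k))) = (SUP x. \<bar>f (cl x) - (\<Sum>k<n. a k * \<phi> k (cl x))\<bar>)"
      by (simp add: norm_bcontfun_def dist_bcontfun.rep_eq dist_real_def B_apply[OF f] sum_apply)
    also have "\<dots> = (SUP y\<in>range cl. \<bar>f y - (\<Sum>k<n. a k * \<phi> k y)\<bar>)"
      by (simp add: image_image)
    finally show ?thesis by (simp add: sup_dist_def cl_range)
  qed
  obtain a where a: "\<And>b. norm (B f - (\<Sum>k<n. a k *\<^sub>R B (\<phi> k))) \<le> norm (B f - (\<Sum>k<n. b k *\<^sub>R B (\<phi> k)))"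
    using best_approximation_in_span[of "B f" "\<lambda>k. B (\<phi> k)" n] by blast
  have "best_approx {q. \<exists>a. \<forall>x. q x = (\<Sum>k<n. a k * \<phi> k x)} f (\<lambda>x. \<Sum>k<n. a k * \<phi> k x)"
    unfolding best_approx_def
  proof (intro conjI ballI)
    fix r assume "r \<in> {q. \<exists>a. \<forall>x. q x = (\<Sum>k<n. a k * \<phi> k x)}"
    then obtain b where "\<forall>x. r x = (\<Sum>k<n. b k * \<phi> k x)" by blast
    then have r: "r = (\<lambda>x. \<Sum>k<n. b k * \<phi> k x)" by (intro ext) (rule spec)
    show "sup_dist f (\<lambda>x. \<Sum>k<n. a k * \<phi> k x) \<le> sup_dist f r"
      unfolding r key by (rule a)
  qed (intro CollectI exI[of _ a] allI refl)
  then show ?thesis by (rule exI[where x = "\<lambda>x. \<Sum>k<n. a k * \<phi> k x"])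
qed

text \<open>Parity removes the sines, respectively the cosines, which exhibits both classes as spans of
  finitely many fixed functions.\<close>

lemma even_trig_polys_eq:
  "even_trig_polys d = {q. \<exists>a. \<forall>x. q x = (\<Sum>k<Suc d. a k * cos (real k * x))}"
proof (intro equalityI subsetI)
  fix q assume "q \<in> even_trig_polys d"
  then obtain a b where q: "\<And>x. q x = (\<Sum>k\<le>d. a k * cos (real k * x) + b k * sin (real k * x))"
    and ev: "\<And>x. q (-x) = q x"
    by (auto simp: even_trig_polys_def trig_polys_def even_fun_def)
  have "q x = (\<Sum>k<Suc d. a k * cos (real k * x))" for x
  proof -
    have "q x + q (-x) = (\<Sum>k\<le>d. 2 * (a k * cos (real k * x)))"
      unfolding q sum.distrib[symmetric] by (intro sum.cong) auto
    then have "2 * q x = 2 * (\<Sum>k\<le>d. a k * cos (real k * x))"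
      unfolding ev[of x] sum_distrib_left[symmetric] by simp
    then show ?thesis by (simp add: lessThan_Suc_atMost)
  qed
  then show "q \<in> {q. \<exists>a. \<forall>x. q x = (\<Sum>k<Suc d. a k * cos (real k * x))}" by auto
next
  fix q assume "q \<in> {q. \<exists>a. \<forall>x. q x = (\<Sum>k<Suc d. a k * cos (real k * x))}"
  then obtain a where q: "\<And>x. q x = (\<Sum>k\<le>d. a k * cos (real k * x))"
    by (auto simp: lessThan_Suc_atMost)
  have "q \<in> trig_polys d"
    unfolding trig_polys_def by (intro CollectI exI[of _ a] exI[of _ "\<lambda>_. 0"]) (simp add: q)
  then show "q \<in> even_trig_polys d"
    by (simp add: even_trig_polys_def even_fun_def q)
qed

lemma odd_trig_polys_eq:
  "odd_trig_polys d = {q. \<exists>b. \<forall>x. q x = (\<Sum>k<Suc d. b k * sin (real k * x))}"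
proof (intro equalityI subsetI)
  fix q assume "q \<in> odd_trig_polys d"
  then obtain a b where q: "\<And>x. q x = (\<Sum>k\<le>d. a k * cos (real k * x) + b k * sin (real k * x))"
    and ev: "\<And>x. q (-x) = - q x"
    by (auto simp: odd_trig_polys_def trig_polys_def odd_fun_def)
  have "q x = (\<Sum>k<Suc d. b k * sin (real k * x))" for x
  proof -
    have "q x - q (-x) = (\<Sum>k\<le>d. 2 * (b k * sin (real k * x)))"
      unfolding q sum_subtractf[symmetric] by (intro sum.cong) auto
    then have "2 * q x = 2 * (\<Sum>k\<le>d. b k * sin (real k * x))"
      unfolding ev[of x] sum_distrib_left[symmetric] by simp
    then show ?thesis by (simp add: lessThan_Suc_atMost)
  qed
  then show "q \<in> {q. \<exists>b. \<forall>x. q x = (\<Sum>k<Suc d. b k * sin (real k * x))}" by auto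
next
  fix q assume "q \<in> {q. \<exists>b. \<forall>x. q x = (\<Sum>k<Suc d. b k * sin (real k * x))}"
  then obtain b where q: "\<And>x. q x = (\<Sum>k\<le>d. b k * sin (real k * x))"
    by (auto simp: lessThan_Suc_atMost)
  have "q \<in> trig_polys d"
    unfolding trig_polys_def by (intro CollectI exI[of _ "\<lambda>_. 0"] exI[of _ b]) (simp add: q)
  then show "q \<in> odd_trig_polys d"
    by (simp add: odd_trig_polys_def odd_fun_def q sum_negf)
qed

section \<open>Density of trigonometric polynomials\<close>

lemma periodic_representative:
  obtains n :: int where "x + 2 * pi * of_int n \<in> {-pi..pi}"
proof -
  define m where "m = \<lfloor>(x + pi) / (2 * pi)\<rfloor>"
  have "of_int m \<le> (x + pi) / (2 * pi)" "(x + pi) / (2 * pi) < of_int m + 1"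
    unfolding m_def by linarith+
  then have "of_int m * (2 * pi) \<le> x + pi" "x + pi < (of_int m + 1) * (2 * pi)"
    by (simp_all add: field_simps)
  then have "x + 2 * pi * of_int (- m) \<in> {-pi..pi}"
    by (simp add: algebra_simps)
  then show ?thesis by (rule that)
qed

lemma periodic_int:
  fixes g :: "real \<Rightarrow> 'a"
  assumes "\<And>x. g (x + 2 * pi) = g x"
  shows "g (x + 2 * pi * of_int n) = g x"
proof -
  interpret periodic_fun_simple g "2 * pi" by standard (rule assms)
  show ?thesis using plus_of_int[of x n] by (simp add: mult.commute)
qed

definition trig_poly :: "(real \<Rightarrow> real) \<Rightarrow> bool" where
  "trig_poly q \<longleftrightarrow> (\<exists>d. q \<in> trig_polys d)"

lemma trig_polys_mono:
  assumes "q \<in> trig_polys d" "d \<le> e"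
  shows "q \<in> trig_polys e"
proof -
  obtain a b where q: "\<And>x. q x = (\<Sum>k\<le>d. a k * cos (real k * x) + b k * sin (real k * x))"
    using assms by (auto simp: trig_polys_def)
  have "q x = (\<Sum>k\<le>e. (if k \<le> d then a k else 0) * cos (real k * x) +
      (if k \<le> d then b k else 0) * sin (real k * x))" for x
    unfolding q using assms(2) by (intro sum.mono_neutral_cong_left) auto
  then show ?thesis unfolding trig_polys_def by (intro CollectI exI allI)
qed

lemma trig_poly_add:
  assumes "trig_poly p" "trig_poly q"
  shows "trig_poly (\<lambda>x. p x + q x)"
proof -
  obtain d e where "p \<in> trig_polys d" "q \<in> trig_polys e"
    using assms by (auto simp: trig_poly_def)
  then have "p \<in> trig_polys (max d e)" "q \<in> trig_polys (max d e)"
    by (auto intro: trig_polys_mono)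
  then obtain a b a' b' where
    "\<And>x. p x = (\<Sum>k\<le>max d e. a k * cos (real k * x) + b k * sin (real k * x))"
    "\<And>x. q x = (\<Sum>k\<le>max d e. a' k * cos (real k * x) + b' k * sin (real k * x))"
    unfolding trig_polys_def by blast
  then have "p x + q x = (\<Sum>k\<le>max d e. (a k + a' k) * cos (real k * x) + (b k + b' k) * sin (real k * x))" for x
    by (simp only: sum.distrib[symmetric]) (intro sum.cong, auto simp: algebra_simps)
  then show ?thesis unfolding trig_poly_def trig_polys_def by (intro exI CollectI allI)
qed

lemma trig_poly_cmult:
  assumes "trig_poly p"
  shows "trig_poly (\<lambda>x. c * p x)"
proof -
  obtain d a b where
    "\<And>x. p x = (\<Sum>k\<le>d. a k * cos (real k * x) + b k * sin (real k * x))"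
    using assms unfolding trig_poly_def trig_polys_def by blast
  then have "c * p x = (\<Sum>k\<le>d. (c * a k) * cos (real k * x) + (c * b k) * sin (real k * x))" for x
    by (simp only: sum_distrib_left) (intro sum.cong, auto simp: algebra_simps)
  then show ?thesis unfolding trig_poly_def trig_polys_def by (intro exI CollectI allI)
qed

lemma trig_poly_cos_nat: "trig_poly (\<lambda>x. cos (real k * x))"
proof -
  have "cos (real k * x) = (\<Sum>j\<le>k. (if j = k then 1 else 0) * cos (real j * x) + 0 * sin (real j * x))" for x
    by (simp add: if_distrib[where f = "\<lambda>c. c * _"] cong: if_cong)
  then show ?thesis unfolding trig_poly_def trig_polys_def
    by (intro exI[of _ k] CollectI exI[of _ "\<lambda>j. if j = k then 1 else 0"] exI[of _ "\<lambda>_. 0"] allI)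
qed

lemma trig_poly_sin_nat: "trig_poly (\<lambda>x. sin (real k * x))"
proof -
  have "sin (real k * x) = (\<Sum>j\<le>k. 0 * cos (real j * x) + (if j = k then 1 else 0) * sin (real j * x))" for x
    by (simp add: if_distrib[where f = "\<lambda>c. c * _"] cong: if_cong)
  then show ?thesis unfolding trig_poly_def trig_polys_def
    by (intro exI[of _ k] CollectI exI[of _ "\<lambda>j. if j = k then 1 else 0"] exI[of _ "\<lambda>_. 0"] allI)
qed

lemma trig_poly_const: "trig_poly (\<lambda>x. c)"
  using trig_poly_cmult[OF trig_poly_cos_nat[of 0], of c] by simp

lemma trig_poly_sum:
  assumes "\<And>k. k \<in> I \<Longrightarrow> trig_poly (p k)"
  shows "trig_poly (\<lambda>x. \<Sum>k\<in>I. p k x)"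
  using assms by (induction I rule: infinite_finite_induct) (auto intro: trig_poly_add trig_poly_const)

lemma trig_poly_cos_int: "trig_poly (\<lambda>x. cos (of_int m * x))"
proof (cases "m \<ge> 0")
  case True
  then show ?thesis using trig_poly_cos_nat[of "nat m"] by simp
next
  case False
  then have "cos (real (nat (- m)) * x) = cos (of_int m * x)" for x by simp
  then show ?thesis using trig_poly_cos_nat[of "nat (- m)"] by simp
qed

lemma trig_poly_sin_int: "trig_poly (\<lambda>x. sin (of_int m * x))"
proof (cases "m \<ge> 0")
  case True
  then show ?thesis using trig_poly_sin_nat[of "nat m"] by simp
next
  case False
  then have "(-1) * sin (real (nat (- m)) * x) = sin (of_int m * x)" for x by simp
  then show ?thesis using trig_poly_cmult[OF trig_poly_sin_nat[of "nat (- m)"], of "-1"] by simp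
qed

text \<open>Product-to-sum formulas; the frequency \<open>k - j\<close> may be negative, whence the integer versions above.\<close>

lemma trig_poly_mult_basis:
  assumes p: "trig_poly p"
  shows "trig_poly (\<lambda>x. p x * cos (real j * x))" "trig_poly (\<lambda>x. p x * sin (real j * x))"
proof -
  obtain d a b where p: "\<And>x. p x = (\<Sum>k\<le>d. a k * cos (real k * x) + b k * sin (real k * x))"
    using assms unfolding trig_poly_def trig_polys_def by blast
  have "p x * cos (real j * x) =
     (\<Sum>k\<le>d. a k / 2 * (cos (of_int (int k - int j) * x) + cos (of_int (int k + int j) * x)) +
            b k / 2 * (sin (of_int (int k + int j) * x) + sin (of_int (int k - int j) * x)))" for x
    unfolding p sum_distrib_right
    by (intro sum.cong refl) (simp add: algebra_simps sin_add cos_add sin_diff cos_diff)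
  then show "trig_poly (\<lambda>x. p x * cos (real j * x))"
    by (simp only:) (intro trig_poly_sum trig_poly_add trig_poly_cmult trig_poly_cos_int trig_poly_sin_int)
  have "p x * sin (real j * x) =
     (\<Sum>k\<le>d. a k / 2 * (sin (of_int (int k + int j) * x) + (-1) * sin (of_int (int k - int j) * x)) +
            b k / 2 * (cos (of_int (int k - int j) * x) + (-1) * cos (of_int (int k + int j) * x)))" for x
    unfolding p sum_distrib_right
    by (intro sum.cong refl) (simp add: algebra_simps sin_add cos_add sin_diff cos_diff)
  then show "trig_poly (\<lambda>x. p x * sin (real j * x))"
    by (simp only:) (intro trig_poly_sum trig_poly_add trig_poly_cmult trig_poly_cos_int trig_poly_sin_int)
qed

lemma trig_poly_mult:
  assumes p: "trig_poly p" and q: "trig_poly q"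
  shows "trig_poly (\<lambda>x. p x * q x)"
proof -
  obtain d a b where q: "\<And>x. q x = (\<Sum>k\<le>d. a k * cos (real k * x) + b k * sin (real k * x))"
    using q unfolding trig_poly_def trig_polys_def by blast
  have "p x * q x = (\<Sum>k\<le>d. a k * (p x * cos (real k * x)) + b k * (p x * sin (real k * x)))" for x
    unfolding q sum_distrib_left by (intro sum.cong refl) (simp add: algebra_simps)
  then show ?thesis
    by (simp only:) (intro trig_poly_sum trig_poly_add trig_poly_cmult trig_poly_mult_basis p)
qed

text \<open>A continuous \<open>2\<pi>\<close>-periodic function \<open>f\<close> is \<open>h \<circ> cis\<close> for a function \<open>h\<close> on the unit circle, and
  \<open>h\<close> is continuous because \<open>cis\<close> maps the compact interval \<open>[-\<pi>, \<pi>]\<close> onto the circle and hence is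
  a closed map. The functions on the circle that pull back to trigonometric polynomials form an
  algebra that separates points, so the Stone-Weierstrass theorem applies to \<open>h\<close>.\<close>

lemma trigonometric_Weierstrass:
  fixes f :: "real \<Rightarrow> real"
  assumes cont: "continuous_on UNIV f" and per: "\<And>x. f (x + 2 * pi) = f x" and "e > 0"
  obtains q where "trig_poly q" "\<And>x. \<bar>f x - q x\<bar> < e"
proof -
  let ?S = "sphere (0 :: complex) 1"
  define h where "h z = f (Arg z)" for z
  have h_cis: "h (cis t) = f t" for t
  proof -
    have "cis (Arg (cis t)) = cis t" by (simp add: cis_Arg)
    then have "sin (Arg (cis t)) = sin t \<and> cos (Arg (cis t)) = cos t"
      by (simp add: complex_eq_iff)
    then obtain n :: int where "Arg (cis t) = t + 2 * pi * of_int n"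
      using sin_cos_eq_iff by blast
    then show ?thesis using periodic_int[of f t n] per by (simp add: h_def)
  qed
  have sphere_cis: "\<exists>t\<in>{-pi..pi}. z = cis t" if "z \<in> ?S" for z
  proof -
    have "z \<noteq> 0" using that by auto
    then have "z = cis (Arg z)" using that by (simp add: cis_Arg sgn_div_norm)
    moreover have "Arg z \<in> {-pi..pi}" using Arg_bounded[of z] by auto
    ultimately show ?thesis by blast
  qed
  have "continuous_on ?S h"
    unfolding continuous_on_closed_vimage[OF closed_sphere]
  proof (intro allI impI)
    fix C :: "real set" assume "closed C"
    have "h -` C \<inter> ?S = cis ` (f -` C \<inter> {-pi..pi})"
    proof (intro equalityI subsetI)
      fix z assume z: "z \<in> h -` C \<inter> ?S"
      then obtain t where "t \<in> {-pi..pi}" "z = cis t" using sphere_cis by blast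
      then show "z \<in> cis ` (f -` C \<inter> {-pi..pi})" using z by (auto simp: h_cis)
    qed (auto simp: h_cis)
    moreover have "compact (f -` C \<inter> {-pi..pi})"
      using \<open>closed C\<close> continuous_closed_vimage[OF \<open>closed C\<close>] cont
      by (intro closed_Int_compact) (auto simp: continuous_on_eq_continuous_at)
    ultimately show "closed (h -` C \<inter> ?S)"
      by (simp add: compact_imp_closed compact_continuous_image continuous_on_cis)
  qed
  have "\<exists>g. (continuous_on UNIV g \<and> trig_poly (\<lambda>t. g (cis t))) \<and> (\<forall>z\<in>?S. \<bar>h z - g z\<bar> < e)"
  proof (rule Stone_Weierstrass_HOL[where P = "\<lambda>g. continuous_on UNIV g \<and> trig_poly (\<lambda>t. g (cis t))"])
    fix z w :: complex assume "z \<in> ?S \<and> w \<in> ?S \<and> z \<noteq> w"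
    then have "Re z \<noteq> Re w \<or> Im z \<noteq> Im w" by (simp add: complex_eq_iff)
    moreover have "continuous_on UNIV Re \<and> trig_poly (\<lambda>t. Re (cis t))"
      using trig_poly_cos_nat[of 1] by (auto intro: continuous_intros)
    moreover have "continuous_on UNIV Im \<and> trig_poly (\<lambda>t. Im (cis t))"
      using trig_poly_sin_nat[of 1] by (auto intro: continuous_intros)
    ultimately show "\<exists>g. (continuous_on UNIV g \<and> trig_poly (\<lambda>t. g (cis t))) \<and> g z \<noteq> g w"
      by blast
  qed (use \<open>continuous_on ?S h\<close> \<open>e > 0\<close> in
      \<open>auto intro: continuous_intros trig_poly_add trig_poly_mult trig_poly_const continuous_on_subset\<close>)
  then obtain g where trig: "trig_poly (\<lambda>t. g (cis t))" and g: "\<And>z. z \<in> ?S \<Longrightarrow> \<bar>h z - g z\<bar> < e"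
    by blast
  have "\<bar>f t - g (cis t)\<bar> < e" for t
    using g[of "cis t"] by (simp add: h_cis)
  with trig show ?thesis by (rule that)
qed

lemma trig_polys_reflect:
  assumes "q \<in> trig_polys d"
  shows "(\<lambda>x. (q x + q (- x)) / 2) \<in> even_trig_polys d"
    and "(\<lambda>x. (q x - q (- x)) / 2) \<in> odd_trig_polys d"
proof -
  obtain a b where q: "\<And>x. q x = (\<Sum>k\<le>d. a k * cos (real k * x) + b k * sin (real k * x))"
    using assms by (auto simp: trig_polys_def)
  have "(q x + q (- x)) / 2 = (\<Sum>k<Suc d. a k * cos (real k * x))" for x
    unfolding q sum.distrib[symmetric] sum_divide_distrib lessThan_Suc_atMost
    by (intro sum.cong) auto
  then show "(\<lambda>x. (q x + q (- x)) / 2) \<in> even_trig_polys d"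
    unfolding even_trig_polys_eq by blast
  have "(q x - q (- x)) / 2 = (\<Sum>k<Suc d. b k * sin (real k * x))" for x
    unfolding q sum_subtractf[symmetric] sum_divide_distrib lessThan_Suc_atMost
    by (intro sum.cong) auto
  then show "(\<lambda>x. (q x - q (- x)) / 2) \<in> odd_trig_polys d"
    unfolding odd_trig_polys_eq by blast
qed

lemma continuous_trig_polys:
  assumes "q \<in> trig_polys d"
  shows "continuous_on UNIV q"
proof -
  obtain a b where "\<And>x. q x = (\<Sum>k\<le>d. a k * cos (real k * x) + b k * sin (real k * x))"
    using assms by (auto simp: trig_polys_def)
  then have "q = (\<lambda>x. \<Sum>k\<le>d. a k * cos (real k * x) + b k * sin (real k * x))" by blast
  then show ?thesis by (simp only:) (intro continuous_intros)
qed

lemma periodic_trig_polys: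
  assumes "q \<in> trig_polys d"
  shows "q (x + 2 * pi) = q x"
proof -
  obtain a b where q: "\<And>x. q x = (\<Sum>k\<le>d. a k * cos (real k * x) + b k * sin (real k * x))"
    using assms by (auto simp: trig_polys_def)
  have "cos (real k * (x + 2 * pi)) = cos (real k * x)" "sin (real k * (x + 2 * pi)) = sin (real k * x)" for k
  proof -
    have "real k * (x + 2 * pi) = real k * x + 2 * pi * of_int (int k)"
      by (simp add: algebra_simps)
    then show "cos (real k * (x + 2 * pi)) = cos (real k * x)" "sin (real k * (x + 2 * pi)) = sin (real k * x)"
      using periodic_int[of cos "real k * x" "int k"] periodic_int[of sin "real k * x" "int k"] by simp_all
  qed
  then show ?thesis by (simp only: q)
qed

lemma best_approx_error_le:
  assumes f: "continuous_on UNIV f" "\<And>x. f (x + 2 * pi) = f x"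
    and S: "S \<subseteq> trig_polys d" and q: "best_approx S f q"
    and r: "r \<in> S" "\<And>x. \<bar>f x - r x\<bar> < e"
  shows "\<bar>f x - q x\<bar> \<le> e"
proof -
  have q_tp: "q \<in> trig_polys d" using q S by (auto simp: best_approx_def)
  have "sup_dist f q \<le> sup_dist f r" using q r by (auto simp: best_approx_def)
  also have "\<dots> \<le> e"
    unfolding sup_dist_def by (intro cSUP_least) (auto intro: less_imp_le r)
  finally have le: "sup_dist f q \<le> e" .
  have "compact ((\<lambda>x. \<bar>f x - q x\<bar>) ` {-pi..pi})"
    by (intro compact_continuous_image continuous_intros continuous_on_subset[OF f(1)]
        continuous_on_subset[OF continuous_trig_polys[OF q_tp]]) auto
  then have bdd: "bdd_above ((\<lambda>x. \<bar>f x - q x\<bar>) ` {-pi..pi})"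
    by (intro bounded_imp_bdd_above compact_imp_bounded)
  obtain n where n: "x + 2 * pi * of_int n \<in> {-pi..pi}"
    by (rule periodic_representative)
  have "\<bar>f x - q x\<bar> = \<bar>f (x + 2 * pi * of_int n) - q (x + 2 * pi * of_int n)\<bar>"
    by (simp only: periodic_int[of f, OF f(2)] periodic_int[of q, OF periodic_trig_polys[OF q_tp]])
  also have "\<dots> \<le> sup_dist f q"
    unfolding sup_dist_def by (rule cSUP_upper[OF n bdd])
  finally show ?thesis using le by linarith
qed

text \<open>Symmetrizing a good approximation of an even function gives an even approximation that is as
  good; the best one can only improve on it. Odd functions are treated alike.\<close>

lemma best_even_trig_approx:
  assumes f: "continuous_on UNIV f" "\<And>x. f (x + 2 * pi) = f x" and ev: "even_fun f" and e: "e > 0"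
  obtains d q where "best_approx (even_trig_polys d) f q" "\<And>x. \<bar>f x - q x\<bar> \<le> e"
proof -
  obtain d r where r: "r \<in> trig_polys d" "\<And>x. \<bar>f x - r x\<bar> < e"
    using trigonometric_Weierstrass[OF f e] unfolding trig_poly_def by metis
  have "\<exists>q. best_approx (even_trig_polys d) f q"
    unfolding even_trig_polys_eq by (intro best_approx_exists f continuous_intros)
  then obtain q where q: "best_approx (even_trig_polys d) f q" ..
  have "\<bar>f x - (r x + r (- x)) / 2\<bar> < e" for x
    using r(2)[of x] r(2)[of "- x"] ev[unfolded even_fun_def, rule_format, of x]
    by (simp add: abs_less_iff field_simps)
  from best_approx_error_le[OF f _ q trig_polys_reflect(1)[OF r(1)] this] q show ?thesis
    by (intro that) (auto simp: even_trig_polys_def)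
qed

lemma best_odd_trig_approx:
  assumes f: "continuous_on UNIV f" "\<And>x. f (x + 2 * pi) = f x" and odd: "odd_fun f" and e: "e > 0"
  obtains d q where "best_approx (odd_trig_polys d) f q" "\<And>x. \<bar>f x - q x\<bar> \<le> e"
proof -
  obtain d r where r: "r \<in> trig_polys d" "\<And>x. \<bar>f x - r x\<bar> < e"
    using trigonometric_Weierstrass[OF f e] unfolding trig_poly_def by metis
  have "\<exists>q. best_approx (odd_trig_polys d) f q"
    unfolding odd_trig_polys_eq by (intro best_approx_exists f continuous_intros)
  then obtain q where q: "best_approx (odd_trig_polys d) f q" ..
  have "\<bar>f x - (r x - r (- x)) / 2\<bar> < e" for x
    using r(2)[of x] r(2)[of "- x"] odd[unfolded odd_fun_def, rule_format, of x]
    by (simp add: abs_less_iff field_simps)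
  from best_approx_error_le[OF f _ q trig_polys_reflect(2)[OF r(1)] this] q show ?thesis
    by (intro that) (auto simp: odd_trig_polys_def)
qed

section \<open>Toeplitz matrices and their forms\<close>

definition exp_poly :: "nat \<Rightarrow> (nat \<Rightarrow> complex) \<Rightarrow> real \<Rightarrow> complex" where
  "exp_poly n x t = (\<Sum>k<n. x k * exp (\<i> * of_nat k * complex_of_real t))"

lemma continuous_exp_poly [continuous_intros]: "continuous_on T (exp_poly n x)"
  unfolding exp_poly_def by (intro continuous_intros)

lemma set_integral_sum_compact:
  fixes g :: "'i \<Rightarrow> real \<Rightarrow> 'a::{banach, second_countable_topology}"
  assumes "\<And>i. i \<in> I \<Longrightarrow> continuous_on {a..b} (g i)"
  shows "(LBINT t:{a..b}. \<Sum>i\<in>I. g i t) = (\<Sum>i\<in>I. LBINT t:{a..b}. g i t)"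
  unfolding set_lebesgue_integral_def scaleR_sum_right
  using borel_integrable_atLeastAtMost'[OF assms]
  by (intro Bochner_Integration.integral_sum) (simp add: set_integrable_def)

text \<open>The identity behind every estimate below: the sesquilinear form of \<open>T\<^sub>n(h)\<close> is integration against
  \<open>h\<close> of a product of exponential polynomials. It turns bounds on \<open>h\<close> into bounds on \<open>T\<^sub>n(h)\<close> that do
  not depend on \<open>n\<close>.\<close>

lemma toeplitz_form:
  assumes h: "continuous_on {-pi..pi} h"
  shows "(\<Sum>j<n. cnj (z j) * (\<Sum>k<n. toeplitz h n $$ (j, k) * x k)) =
    1 / (2 * complex_of_real pi) * (LBINT t:{-pi..pi}. h t * exp_poly n x t * cnj (exp_poly n z t))"
proof -
  let ?E = "\<lambda>j k t. exp (- \<i> * of_int (int j - int k) * complex_of_real t)"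
  have expand: "h t * exp_poly n x t * cnj (exp_poly n z t) =
      (\<Sum>j<n. \<Sum>k<n. cnj (z j) * x k * (h t * ?E j k t))" for t
  proof -
    have E: "?E j k t = exp (\<i> * of_nat k * complex_of_real t) * cnj (exp (\<i> * of_nat j * complex_of_real t))" for j k
      by (simp add: exp_cnj flip: exp_add) (simp add: algebra_simps)
    have "h t * exp_poly n x t * cnj (exp_poly n z t) =
      (\<Sum>j<n. \<Sum>k<n. h t * (x k * exp (\<i> * of_nat k * complex_of_real t)) *
         (cnj (z j) * cnj (exp (\<i> * of_nat j * complex_of_real t))))"
      unfolding exp_poly_def cnj_sum complex_cnj_mult
      by (simp only: sum_distrib_left sum_distrib_right)
    also have "\<dots> = (\<Sum>j<n. \<Sum>k<n. cnj (z j) * x k * (h t * ?E j k t))"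
      unfolding E by (intro sum.cong refl) (simp only: mult_ac)
    finally show ?thesis .
  qed
  have cont: "continuous_on {-pi..pi} (\<lambda>t. cnj (z j) * x k * (h t * ?E j k t))" for j k
    by (intro continuous_intros h)
  have "(LBINT t:{-pi..pi}. h t * exp_poly n x t * cnj (exp_poly n z t)) =
      (\<Sum>j<n. \<Sum>k<n. cnj (z j) * x k * (LBINT t:{-pi..pi}. h t * ?E j k t))"
    unfolding expand
    by (subst set_integral_sum_compact, intro continuous_on_sum cont)
       (simp only: set_integral_sum_compact[OF cont] set_integral_mult_right)
  moreover have "toeplitz h n $$ (j, k) = 1 / (2 * complex_of_real pi) * (LBINT t:{-pi..pi}. h t * ?E j k t)"
    if "j < n" "k < n" for j k
    using that by (simp add: toeplitz_def)
  ultimately show ?thesis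
    by (simp only: sum_distrib_left) (intro sum.cong refl, simp only: lessThan_iff mult_ac)
qed

lemma integral_exp:
  "(LBINT t:{-pi..pi}. exp (- \<i> * of_int m * complex_of_real t)) = (if m = 0 then 2 * complex_of_real pi else 0)"
proof (cases "m = 0")
  case True
  have "(LBINT t:{-pi..pi}. (1::complex)) = 2 * complex_of_real pi"
    unfolding set_lebesgue_integral_def
    by (subst integral_FTC_atLeastAtMost[where F = "\<lambda>t. complex_of_real t"])
       (auto intro!: derivative_eq_intros has_vector_derivative_of_real)
  then show ?thesis using True by simp
next
  case False
  let ?c = "- \<i> * of_int m :: complex"
  have c: "?c \<noteq> 0" using False by simp
  have "(LBINT t:{-pi..pi}. exp (?c * complex_of_real t)) =
      exp (?c * complex_of_real pi) / ?c - exp (?c * complex_of_real (-pi)) / ?c"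
    unfolding set_lebesgue_integral_def
  proof (rule integral_FTC_atLeastAtMost)
    fix t :: real
    have "((\<lambda>z. exp (?c * z) / ?c) has_field_derivative exp (?c * of_real t)) (at (of_real t))"
      using c by (auto intro!: derivative_eq_intros)
    then show "((\<lambda>t. exp (?c * complex_of_real t) / ?c) has_vector_derivative exp (?c * of_real t)) (at t within {-pi..pi})"
      by (rule has_vector_derivative_real_field)
  qed (auto intro!: continuous_intros)
  moreover have "exp (?c * complex_of_real pi) = exp (?c * complex_of_real (-pi))"
    unfolding exp_eq by (intro exI[of _ "- m"]) (simp add: algebra_simps)
  ultimately show ?thesis using False by simp
qed

lemma toeplitz_one:
  assumes "j < n" "k < n"
  shows "toeplitz (\<lambda>_. 1) n $$ (j, k) = (if j = k then 1 else 0)"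
  using assms integral_exp[of "int j - int k"] by (simp add: toeplitz_def)

definition sq_norm :: "nat \<Rightarrow> (nat \<Rightarrow> complex) \<Rightarrow> real" where
  "sq_norm n x = (\<Sum>k<n. (cmod (x k))\<^sup>2)"

text \<open>The form identity for \<open>h = 1\<close>, where \<open>T\<^sub>n(h)\<close> is the identity matrix.\<close>

lemma Parseval:
  "(LBINT t:{-pi..pi}. (cmod (exp_poly n x t))\<^sup>2) = 2 * pi * sq_norm n x"
proof -
  have "(\<Sum>j<n. cnj (x j) * (\<Sum>k<n. toeplitz (\<lambda>_. 1) n $$ (j, k) * x k)) = (\<Sum>j<n. complex_of_real ((cmod (x j))\<^sup>2))"
  proof (intro sum.cong refl)
    fix j assume j: "j \<in> {..<n}"
    have "(\<Sum>k<n. toeplitz (\<lambda>_. 1) n $$ (j, k) * x k) = (\<Sum>k<n. if j = k then x k else 0)"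
      using j by (intro sum.cong) (auto simp: toeplitz_one)
    also have "\<dots> = x j" using j by simp
    finally have "(\<Sum>k<n. toeplitz (\<lambda>_. 1) n $$ (j, k) * x k) = x j" .
    then show "cnj (x j) * (\<Sum>k<n. toeplitz (\<lambda>_. 1) n $$ (j, k) * x k) = complex_of_real ((cmod (x j))\<^sup>2)"
      by (simp only: complex_norm_square mult.commute)
  qed
  then have "complex_of_real (sq_norm n x) =
      (\<Sum>j<n. cnj (x j) * (\<Sum>k<n. toeplitz (\<lambda>_. 1) n $$ (j, k) * x k))"
    by (simp only: sq_norm_def of_real_sum)
  also have "\<dots> = 1 / (2 * complex_of_real pi) *
      (LBINT t:{-pi..pi}. 1 * exp_poly n x t * cnj (exp_poly n x t))"
    by (intro toeplitz_form continuous_intros)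
  also have "\<dots> = 1 / (2 * complex_of_real pi) *
      (LBINT t:{-pi..pi}. complex_of_real ((cmod (exp_poly n x t))\<^sup>2))"
    by (simp only: complex_norm_square mult_1_left)
  finally have "complex_of_real (sq_norm n x) = 1 / (2 * complex_of_real pi) *
      (LBINT t:{-pi..pi}. complex_of_real ((cmod (exp_poly n x t))\<^sup>2))" .
  then have "complex_of_real (sq_norm n x) =
      complex_of_real (1 / (2 * pi) * (LBINT t:{-pi..pi}. (cmod (exp_poly n x t))\<^sup>2))"
    unfolding set_integral_complex_of_real by (simp only: of_real_mult of_real_divide of_real_1 of_real_numeral)
  then have "sq_norm n x = 1 / (2 * pi) * (LBINT t:{-pi..pi}. (cmod (exp_poly n x t))\<^sup>2)"
    by (simp only: of_real_eq_iff)
  then show ?thesis by simp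
qed

lemma toeplitz_form_coercive:
  assumes h: "continuous_on {-pi..pi} h" and c: "\<And>t. t \<in> {-pi..pi} \<Longrightarrow> c \<le> Re (h t)"
  shows "c * sq_norm n z \<le> Re (\<Sum>j<n. cnj (z j) * (\<Sum>k<n. toeplitz h n $$ (j, k) * z k))"
proof -
  have int: "set_integrable lborel {-pi..pi} (\<lambda>t. h t * exp_poly n z t * cnj (exp_poly n z t))"
    by (intro borel_integrable_atLeastAtMost' continuous_intros h)
  have Re_eq: "Re (h t * exp_poly n z t * cnj (exp_poly n z t)) = Re (h t) * (cmod (exp_poly n z t))\<^sup>2" for t
    by (simp add: mult.assoc flip: complex_norm_square of_real_power)
  have "c * (2 * pi * sq_norm n z) = (LBINT t:{-pi..pi}. c * (cmod (exp_poly n z t))\<^sup>2)"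
    by (simp add: Parseval)
  also have "\<dots> \<le> (LBINT t:{-pi..pi}. Re (h t) * (cmod (exp_poly n z t))\<^sup>2)"
    by (intro set_integral_mono borel_integrable_atLeastAtMost' continuous_intros h mult_right_mono c) auto
  also have "\<dots> = Re (LBINT t:{-pi..pi}. h t * exp_poly n z t * cnj (exp_poly n z t))"
    unfolding set_lebesgue_integral_def Re_eq[symmetric] integral_Re[OF int[unfolded set_integrable_def], symmetric]
    by (simp only: scaleR_complex.sel real_scaleR_def)
  finally have "c * sq_norm n z \<le>
      Re (LBINT t:{-pi..pi}. h t * exp_poly n z t * cnj (exp_poly n z t)) / (2 * pi)"
    by (simp add: pos_le_divide_eq mult.commute mult.left_commute)
  moreover have "1 / (2 * complex_of_real pi) * I = I / complex_of_real (2 * pi)" for I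
    by simp
  ultimately show ?thesis
    unfolding toeplitz_form[OF h] by (simp only: Re_divide_of_real)
qed

text \<open>The free parameter \<open>s\<close> of the weighted inequality \<open>2ab \<le> s a\<^sup>2 + b\<^sup>2 / s\<close> replaces the Cauchy-Schwarz
  inequality; the application chooses it.\<close>

lemma toeplitz_form_bound:
  assumes h: "continuous_on {-pi..pi} h" and e: "\<And>t. t \<in> {-pi..pi} \<Longrightarrow> cmod (h t) \<le> e" and s: "s > 0"
  shows "cmod (\<Sum>j<n. cnj (z j) * (\<Sum>k<n. toeplitz h n $$ (j, k) * x k)) \<le>
    e * (s * sq_norm n x + sq_norm n z / s) / 2"
proof -
  let ?X = "\<lambda>t. cmod (exp_poly n x t)" and ?Z = "\<lambda>t. cmod (exp_poly n z t)"
  have e0: "e \<ge> 0" by (rule order_trans[OF norm_ge_zero e[of 0]]) simp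
  have AMGM: "a * b \<le> s * a\<^sup>2 / 2 + b\<^sup>2 / s / 2" for a b :: real
  proof -
    have "0 \<le> (s * a - b)\<^sup>2 / (2 * s)" using s by simp
    also have "\<dots> = s * a\<^sup>2 / 2 + b\<^sup>2 / s / 2 - a * b"
      using s by (simp add: power2_eq_square field_simps)
    finally show ?thesis by simp
  qed
  have "cmod (LBINT t:{-pi..pi}. h t * exp_poly n x t * cnj (exp_poly n z t)) \<le>
      (LBINT t:{-pi..pi}. cmod (h t * exp_poly n x t * cnj (exp_poly n z t)))"
    by (intro set_integral_norm_bound borel_integrable_atLeastAtMost' continuous_intros h)
  also have "\<dots> \<le> (LBINT t:{-pi..pi}. (e * s / 2) * (?X t)\<^sup>2 + (e / s / 2) * (?Z t)\<^sup>2)"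
  proof (intro set_integral_mono borel_integrable_atLeastAtMost' continuous_intros h)
    fix t assume "t \<in> {-pi..pi}"
    then have "cmod (h t) * (?X t * ?Z t) \<le> e * (s * (?X t)\<^sup>2 / 2 + (?Z t)\<^sup>2 / s / 2)"
      by (intro mult_mono e AMGM e0) auto
    then show "cmod (h t * exp_poly n x t * cnj (exp_poly n z t)) \<le>
        (e * s / 2) * (?X t)\<^sup>2 + (e / s / 2) * (?Z t)\<^sup>2"
      by (simp add: norm_mult algebra_simps)
  qed
  also have "\<dots> = (e * s / 2) * (2 * pi * sq_norm n x) + (e / s / 2) * (2 * pi * sq_norm n z)"
    by (subst set_integral_add, intro borel_integrable_atLeastAtMost' continuous_intros,
        intro borel_integrable_atLeastAtMost' continuous_intros)
       (simp only: set_integral_mult_right Parseval)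
  also have "\<dots> = 2 * pi * (e * (s * sq_norm n x + sq_norm n z / s) / 2)"
    using s by (simp add: field_simps)
  finally have "cmod (LBINT t:{-pi..pi}. h t * exp_poly n x t * cnj (exp_poly n z t)) \<le>
      2 * pi * (e * (s * sq_norm n x + sq_norm n z / s) / 2)" .
  moreover have "cmod (1 / (2 * complex_of_real pi)) = 1 / (2 * pi)"
    by (simp add: norm_divide norm_mult)
  ultimately show ?thesis
    unfolding toeplitz_form[OF h] norm_mult by (simp add: pos_divide_le_eq mult.commute)
qed

text \<open>This is \<open>norm (T\<^sub>n(p)\<^sup>-\<^sup>1 T\<^sub>n(f - p)) \<le> e / c\<close> in a form that avoids inverses. Test the equation
  with \<open>z\<close> itself: coercivity bounds \<open>c sq_norm z\<close> by the form of \<open>f - p\<close>, and the weight \<open>s = e / c\<close>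
  lets half of the left side absorb the \<open>z\<close> term on the right.\<close>

lemma toeplitz_solution_bound:
  assumes p: "continuous_on {-pi..pi} p" and f: "continuous_on {-pi..pi} f"
    and c: "c > 0" "\<And>t. t \<in> {-pi..pi} \<Longrightarrow> c \<le> Re (p t)"
    and e: "e > 0" "\<And>t. t \<in> {-pi..pi} \<Longrightarrow> cmod (f t - p t) \<le> e"
    and eq: "\<And>j. j < n \<Longrightarrow> (\<Sum>k<n. toeplitz p n $$ (j, k) * z k) = (\<Sum>k<n. toeplitz (\<lambda>t. f t - p t) n $$ (j, k) * x k)"
  shows "sq_norm n z \<le> (e / c)\<^sup>2 * sq_norm n x"
proof -
  have s: "e / c > 0" using c e by simp
  have "c * sq_norm n z \<le> Re (\<Sum>j<n. cnj (z j) * (\<Sum>k<n. toeplitz p n $$ (j, k) * z k))"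
    by (intro toeplitz_form_coercive p c)
  also have "\<dots> = Re (\<Sum>j<n. cnj (z j) * (\<Sum>k<n. toeplitz (\<lambda>t. f t - p t) n $$ (j, k) * x k))"
    by (intro arg_cong[of _ _ Re] sum.cong refl) (simp only: lessThan_iff eq)
  also have "\<dots> \<le> cmod (\<Sum>j<n. cnj (z j) * (\<Sum>k<n. toeplitz (\<lambda>t. f t - p t) n $$ (j, k) * x k))"
    by (rule complex_Re_le_cmod)
  also have "\<dots> \<le> e * (e / c * sq_norm n x + sq_norm n z / (e / c)) / 2"
    by (intro toeplitz_form_bound continuous_intros f p e s)
  also have "\<dots> = c * ((e / c)\<^sup>2 * sq_norm n x + sq_norm n z) / 2"
    using c e by (simp add: field_simps power2_eq_square)
  finally have "c * sq_norm n z \<le> c * (((e / c)\<^sup>2 * sq_norm n x + sq_norm n z) / 2)" by simp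
  then have "sq_norm n z \<le> ((e / c)\<^sup>2 * sq_norm n x + sq_norm n z) / 2"
    using c(1) by (simp only: mult_le_cancel_left_pos)
  then show ?thesis by simp
qed

lemma toeplitz_carrier: "toeplitz h n \<in> carrier_mat n n"
  by (simp add: toeplitz_def)

lemma mult_mat_vec_sum:
  assumes "A \<in> carrier_mat n n" "v \<in> carrier_vec n" "j < n"
  shows "(A *\<^sub>v v) $ j = (\<Sum>k<n. A $$ (j, k) * v $ k)"
  using assms by (auto simp: scalar_prod_def atLeast0LessThan intro!: sum.cong)

lemma toeplitz_diff:
  assumes "continuous_on {-pi..pi} f" "continuous_on {-pi..pi} p" "j < n" "k < n"
  shows "toeplitz (\<lambda>t. f t - p t) n $$ (j, k) = toeplitz f n $$ (j, k) - toeplitz p n $$ (j, k)"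
proof -
  let ?E = "\<lambda>t. exp (- \<i> * of_int (int j - int k) * complex_of_real t)"
  have "(LBINT t:{-pi..pi}. (f t - p t) * ?E t) = (LBINT t:{-pi..pi}. f t * ?E t) - (LBINT t:{-pi..pi}. p t * ?E t)"
    unfolding left_diff_distrib
    by (intro set_integral_diff borel_integrable_atLeastAtMost' continuous_intros assms)
  then show ?thesis using assms by (simp add: toeplitz_def right_diff_distrib diff_divide_distrib)
qed

lemma sq_norm_nonneg: "sq_norm n x \<ge> 0"
  by (simp add: sq_norm_def sum_nonneg)

lemma sq_norm_eq_0:
  assumes "v \<in> carrier_vec n"
  shows "sq_norm n (vec_index v) = 0 \<longleftrightarrow> v = 0\<^sub>v n"
  using assms by (auto simp: sq_norm_def sum_nonneg_eq_0_iff)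

text \<open>A coercive form has trivial kernel.\<close>

lemma toeplitz_inverse:
  assumes p: "continuous_on {-pi..pi} p" and c: "c > 0" "\<And>t. t \<in> {-pi..pi} \<Longrightarrow> c \<le> Re (p t)"
  obtains B where "mat_inverse (toeplitz p n) = Some B" "B \<in> carrier_mat n n"
    "toeplitz p n * B = 1\<^sub>m n" "B * toeplitz p n = 1\<^sub>m n"
proof -
  let ?T = "toeplitz p n"
  have "det ?T \<noteq> 0"
  proof
    assume "det ?T = 0"
    then obtain v where v: "v \<in> carrier_vec n" "v \<noteq> 0\<^sub>v n" "?T *\<^sub>v v = 0\<^sub>v n"
      using det_0_iff_vec_prod_zero[OF toeplitz_carrier] by blast
    have "(\<Sum>k<n. ?T $$ (j, k) * v $ k) = 0" if "j < n" for j
      using mult_mat_vec_sum[OF toeplitz_carrier v(1) that, of p] that v(3) by simp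
    then have "Re (\<Sum>j<n. cnj (v $ j) * (\<Sum>k<n. ?T $$ (j, k) * v $ k)) = 0"
      by simp
    then have "c * sq_norm n (vec_index v) \<le> 0"
      using toeplitz_form_coercive[OF p c(2), of n "vec_index v"] by simp
    then have "sq_norm n (vec_index v) = 0"
      using c(1) sq_norm_nonneg[of n "vec_index v"] by (simp add: mult_le_0_iff)
    with v(1,2) show False by (simp add: sq_norm_eq_0)
  qed
  then have "?T \<in> Units (ring_mat TYPE(complex) n ())"
    by (rule det_non_zero_imp_unit[OF toeplitz_carrier])
  then have "mat_inverse ?T \<noteq> None"
    using mat_inverse(1)[OF toeplitz_carrier, where b = "()"] by blast
  then obtain B where "mat_inverse ?T = Some B" by blast
  with mat_inverse(2)[OF toeplitz_carrier this] show ?thesis by (intro that) auto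
qed

section \<open>Singular values\<close>

lemma sqrt_sq_norm_triangle: "sqrt (sq_norm n (\<lambda>k. x k + y k)) \<le> sqrt (sq_norm n x) + sqrt (sq_norm n y)"
proof -
  have "sqrt (sq_norm n (\<lambda>k. x k + y k)) \<le> L2_set (\<lambda>k. cmod (x k) + cmod (y k)) {..<n}"
    unfolding sq_norm_def L2_set_def
    by (intro real_sqrt_le_mono sum_mono power_mono norm_triangle_ineq) auto
  also have "\<dots> \<le> L2_set (\<lambda>k. cmod (x k)) {..<n} + L2_set (\<lambda>k. cmod (y k)) {..<n}"
    by (rule L2_set_triangle_ineq)
  finally show ?thesis by (simp add: L2_set_def sq_norm_def)
qed

text \<open>The computation \<open>\<langle>A v, A v\<rangle> = \<langle>A\<^sup>* A v, v\<rangle> = l \<langle>v, v\<rangle>\<close>.\<close>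

lemma sq_norm_adjoint_eigenvector:
  assumes A: "A \<in> carrier_mat n n" and v: "v \<in> carrier_vec n"
    and eig: "(mat_adjoint A * A) *\<^sub>v v = l \<cdot>\<^sub>v v"
  shows "complex_of_real (sq_norm n (vec_index (A *\<^sub>v v))) = l * complex_of_real (sq_norm n (vec_index v))"
proof -
  let ?w = "A *\<^sub>v v"
  have adj: "mat_adjoint A \<in> carrier_mat n n"
    using A by (auto simp: mat_adjoint_def)
  have adj_index: "mat_adjoint A $$ (i, j) = cnj (A $$ (j, i))" if "i < n" "j < n" for i j
    using A that by (simp add: mat_adjoint_def mat_of_rows_index)
  have w: "?w \<in> carrier_vec n" using A v by simp
  have lv: "mat_adjoint A *\<^sub>v ?w = l \<cdot>\<^sub>v v"
    using eig A v adj by (simp add: assoc_mult_mat_vec)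
  have "l * complex_of_real (sq_norm n (vec_index v)) = (\<Sum>i<n. cnj (v $ i) * (l * v $ i))"
    unfolding sq_norm_def of_real_sum complex_norm_square sum_distrib_left
    by (intro sum.cong refl) (simp only: mult_ac)
  also have "\<dots> = (\<Sum>i<n. cnj (v $ i) * (\<Sum>j<n. cnj (A $$ (j, i)) * ?w $ j))"
  proof (intro sum.cong refl)
    fix i assume i: "i \<in> {..<n}"
    have "l * v $ i = (mat_adjoint A *\<^sub>v ?w) $ i" using i v by (simp add: lv)
    also have "\<dots> = (\<Sum>j<n. mat_adjoint A $$ (i, j) * ?w $ j)"
      using i by (intro mult_mat_vec_sum adj w) simp
    also have "\<dots> = (\<Sum>j<n. cnj (A $$ (j, i)) * ?w $ j)"
      using i by (intro sum.cong) (auto simp: adj_index)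
    finally show "cnj (v $ i) * (l * v $ i) = cnj (v $ i) * (\<Sum>j<n. cnj (A $$ (j, i)) * ?w $ j)"
      by simp
  qed
  also have "\<dots> = (\<Sum>j<n. \<Sum>i<n. cnj (v $ i) * (cnj (A $$ (j, i)) * ?w $ j))"
    unfolding sum_distrib_left by (rule sum.swap)
  also have "\<dots> = (\<Sum>j<n. ?w $ j * cnj (\<Sum>i<n. A $$ (j, i) * v $ i))"
    unfolding cnj_sum sum_distrib_left complex_cnj_mult
    by (intro sum.cong refl) (simp only: mult_ac)
  also have "\<dots> = (\<Sum>j<n. ?w $ j * cnj (?w $ j))"
    by (intro sum.cong refl) (simp only: mult_mat_vec_sum[OF A v] lessThan_iff)
  also have "\<dots> = complex_of_real (sq_norm n (vec_index ?w))"
    unfolding sq_norm_def of_real_sum complex_norm_square ..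
  finally show ?thesis by simp
qed

text \<open>A singular value is the ratio \<open>norm (A v) / norm v\<close> for an eigenvector \<open>v\<close> of \<open>A\<^sup>* A\<close>, and the
  triangle inequality compares \<open>norm (A v)\<close> with \<open>norm v\<close>.\<close>

lemma singular_value_near_one:
  assumes A: "A \<in> carrier_mat n n"
    and near: "\<And>v. v \<in> carrier_vec n \<Longrightarrow>
      sqrt (sq_norm n (\<lambda>k. (A *\<^sub>v v) $ k - v $ k)) \<le> r * sqrt (sq_norm n (vec_index v))"
    and s: "s \<in># singular_values A"
  shows "\<bar>s - 1\<bar> \<le> r"
proof -
  let ?G = "mat_adjoint A * A"
  have G: "?G \<in> carrier_mat n n" using A by (auto simp: mat_adjoint_def)
  have nz: "char_poly ?G \<noteq> 0" using degree_monic_char_poly[OF G] by auto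
  from s obtain l where l: "poly (char_poly ?G) l = 0" "s = sqrt (Re l)"
    using nz by (auto simp: singular_values_def)
  then have "eigenvalue ?G l" by (simp add: eigenvalue_root_char_poly[OF G])
  then obtain v where v: "v \<in> carrier_vec n" "v \<noteq> 0\<^sub>v n" and eig: "?G *\<^sub>v v = l \<cdot>\<^sub>v v"
    using G unfolding eigenvalue_def eigenvector_def by auto
  let ?w = "A *\<^sub>v v"
  let ?N = "sqrt (sq_norm n (vec_index v))"
  have Npos: "?N > 0"
    using v sq_norm_nonneg[of n "vec_index v"] by (simp add: sq_norm_eq_0 less_le)
  have "sq_norm n (vec_index ?w) = Re l * sq_norm n (vec_index v)"
    using arg_cong[OF sq_norm_adjoint_eigenvector[OF A v(1) eig], of Re] by simp
  then have sN: "sqrt (sq_norm n (vec_index ?w)) = s * ?N"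
    by (simp add: l real_sqrt_mult)
  let ?D = "sqrt (sq_norm n (\<lambda>k. ?w $ k - v $ k))"
  have "sqrt (sq_norm n (vec_index ?w)) \<le> ?D + ?N"
    using sqrt_sq_norm_triangle[of n "\<lambda>k. ?w $ k - v $ k" "vec_index v"] by simp
  moreover have "?N \<le> ?D + sqrt (sq_norm n (vec_index ?w))"
    using sqrt_sq_norm_triangle[of n "\<lambda>k. v $ k - ?w $ k" "vec_index ?w"]
    by (simp add: sq_norm_def norm_minus_commute)
  ultimately have "\<bar>s * ?N - ?N\<bar> \<le> r * ?N"
    using near[OF v(1)] unfolding sN by linarith
  moreover have "\<bar>s * ?N - ?N\<bar> = \<bar>s - 1\<bar> * ?N"
  proof -
    have "s * ?N - ?N = (s - 1) * ?N" by (simp only: left_diff_distrib mult_1_left)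
    then show ?thesis by (simp only: abs_mult abs_of_pos[OF Npos])
  qed
  ultimately show ?thesis using Npos by (simp only: mult_le_cancel_right_pos)
qed

text \<open>For \<open>A = T\<^sub>n(p)\<^sup>-\<^sup>1 T\<^sub>n(f)\<close> the vector \<open>z = A v - v\<close> solves \<open>T\<^sub>n(p) z = T\<^sub>n(f - p) v\<close>.\<close>

lemma preconditioned_singular_values:
  assumes p: "continuous_on {-pi..pi} p" and f: "continuous_on {-pi..pi} f"
    and c: "c > 0" "\<And>t. t \<in> {-pi..pi} \<Longrightarrow> c \<le> Re (p t)"
    and e: "e > 0" "\<And>t. t \<in> {-pi..pi} \<Longrightarrow> cmod (f t - p t) \<le> e"
    and s: "s \<in># singular_values (the (mat_inverse (toeplitz p n)) * toeplitz f n)"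
  shows "\<bar>s - 1\<bar> \<le> e / c"
proof -
  obtain B where B: "mat_inverse (toeplitz p n) = Some B" "B \<in> carrier_mat n n"
    "toeplitz p n * B = 1\<^sub>m n" "B * toeplitz p n = 1\<^sub>m n"
    by (rule toeplitz_inverse[OF p c])
  let ?A = "B * toeplitz f n"
  have A: "?A \<in> carrier_mat n n" using B toeplitz_carrier by auto
  show ?thesis
  proof (rule singular_value_near_one[OF A])
    show "s \<in># singular_values ?A" using s B by simp
    fix v :: "complex Matrix.vec" assume v: "v \<in> carrier_vec n"
    let ?w = "?A *\<^sub>v v"
    have w: "?w \<in> carrier_vec n" using A v by simp
    have Tw: "toeplitz p n *\<^sub>v ?w = toeplitz f n *\<^sub>v v"
    proof -
      have "toeplitz p n *\<^sub>v ?w = (toeplitz p n * ?A) *\<^sub>v v"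
        by (rule assoc_mult_mat_vec[OF toeplitz_carrier A v, symmetric])
      also have "toeplitz p n * ?A = (toeplitz p n * B) * toeplitz f n"
        by (rule assoc_mult_mat[OF toeplitz_carrier B(2) toeplitz_carrier, symmetric])
      also have "\<dots> = toeplitz f n"
        using B(3) by (simp add: left_mult_one_mat[OF toeplitz_carrier])
      finally show ?thesis .
    qed
    have "sq_norm n (\<lambda>k. ?w $ k - v $ k) \<le> (e / c)\<^sup>2 * sq_norm n (vec_index v)"
    proof (rule toeplitz_solution_bound[OF p f c e])
      fix j assume j: "j < n"
      have "(\<Sum>k<n. toeplitz p n $$ (j, k) * (?w $ k - v $ k)) =
          (\<Sum>k<n. toeplitz p n $$ (j, k) * ?w $ k) - (\<Sum>k<n. toeplitz p n $$ (j, k) * v $ k)"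
        by (simp only: right_diff_distrib sum_subtractf)
      also have "(\<Sum>k<n. toeplitz p n $$ (j, k) * ?w $ k) = (\<Sum>k<n. toeplitz f n $$ (j, k) * v $ k)"
        by (simp only: mult_mat_vec_sum[OF toeplitz_carrier w j, symmetric]
            mult_mat_vec_sum[OF toeplitz_carrier v j, symmetric] Tw)
      also have "\<dots> - (\<Sum>k<n. toeplitz p n $$ (j, k) * v $ k) =
          (\<Sum>k<n. toeplitz (\<lambda>t. f t - p t) n $$ (j, k) * v $ k)"
        unfolding sum_subtractf[symmetric] left_diff_distrib[symmetric]
        using j by (intro sum.cong refl) (simp add: toeplitz_diff[OF f p])
      finally show "(\<Sum>k<n. toeplitz p n $$ (j, k) * (?w $ k - v $ k)) =
          (\<Sum>k<n. toeplitz (\<lambda>t. f t - p t) n $$ (j, k) * v $ k)" .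
    qed
    then have "sqrt (sq_norm n (\<lambda>k. ?w $ k - v $ k)) \<le> sqrt ((e / c)\<^sup>2 * sq_norm n (vec_index v))"
      by (rule real_sqrt_le_mono)
    also have "\<dots> = e / c * sqrt (sq_norm n (vec_index v))"
      using c(1) e(1) by (simp add: real_sqrt_mult)
    finally show "sqrt (sq_norm n (\<lambda>k. ?w $ k - v $ k)) \<le> e / c * sqrt (sq_norm n (vec_index v))" .
  qed
qed

section \<open>The cluster of the preconditioned matrices\<close>

theorem mainTheorem3:
  fixes f1 f2 :: "real \<Rightarrow> real" and f :: "real \<Rightarrow> complex" and \<epsilon> :: real
  assumes "continuous_on UNIV f1" and "continuous_on UNIV f2"
    and "\<forall>x. f1 (x + 2 * pi) = f1 x" and "\<forall>x. f2 (x + 2 * pi) = f2 x"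
    and "bounded (range f1)" and "bounded (range f2)"
    and "\<forall>x. f1 x > 0" and "even_fun f1" and "odd_fun f2"
    and "\<forall>x. f x = of_real (f1 x) + \<i> * of_real (f2 x)"
    and "\<epsilon> > 0"
  shows "\<exists>d1 d2 p1 p2.
     best_approx (even_trig_polys d1) f1 p1 \<and>
     best_approx (odd_trig_polys d2) f2 p2 \<and>
     (\<forall>x. (p1 x)\<^sup>2 + (p2 x)\<^sup>2 > 0) \<and>
     (let p = (\<lambda>x. of_real (p1 x) + \<i> * of_real (p2 x));
          M = (SUP x\<in>{-pi..pi}. sqrt (1 / ((p1 x)\<^sup>2 + (p2 x)\<^sup>2)))
      in (\<forall>n\<ge>1. invertible_mat (toeplitz p n)) \<and>
         general_cluster (\<lambda>n. the (mat_inverse (toeplitz p n)) * toeplitz f n)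
           {1 - M * \<epsilon> .. 1 + M * \<epsilon>})"
proof -
  have f1: "continuous_on UNIV f1" "\<And>x. f1 (x + 2 * pi) = f1 x"
    and f2: "continuous_on UNIV f2" "\<And>x. f2 (x + 2 * pi) = f2 x"
    using assms by auto
  obtain x0 where x0: "x0 \<in> {-pi..pi}" "\<And>x. x \<in> {-pi..pi} \<Longrightarrow> f1 x0 \<le> f1 x"
    using continuous_attains_inf[of "{-pi..pi}" f1] continuous_on_subset[OF f1(1)] by auto
  define m where "m = f1 x0"
  have m: "m > 0" using assms(7) by (simp add: m_def)
  have f1_ge: "m \<le> f1 x" for x
  proof -
    obtain k where k: "x + 2 * pi * of_int k \<in> {-pi..pi}" by (rule periodic_representative)
    then show ?thesis using x0(2)[OF k] periodic_int[of f1, OF f1(2)] by (simp add: m_def)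
  qed
  \<comment> \<open>\<open>c\<close> will bound \<open>p1\<close> from below and \<open>K\<close> will bound \<open>p1 0\<close> from above; both are fixed before \<open>p1\<close> is chosen.\<close>
  define c where "c = m / 2"
  define K where "K = f1 0 + c"
  have f10: "f1 0 > 0" using assms(7) by simp
  have c: "c > 0" and K: "K > 0" using m f10 by (simp_all add: c_def K_def)
  define e where "e = min c (c * \<epsilon> / (2 * K))"
  have e: "e > 0" "e \<le> c" "2 * e / c \<le> \<epsilon> / K"
  proof -
    show "e > 0" using c K \<open>\<epsilon> > 0\<close> by (simp add: e_def)
    show "e \<le> c" by (simp add: e_def)
    have "e \<le> c * \<epsilon> / (2 * K)" by (simp add: e_def)
    then show "2 * e / c \<le> \<epsilon> / K" using c K by (simp add: field_simps)
  qed
  obtain d1 p1 where best1: "best_approx (even_trig_polys d1) f1 p1"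
    and p1: "\<And>x. \<bar>f1 x - p1 x\<bar> \<le> e"
    using best_even_trig_approx[OF f1 \<open>even_fun f1\<close> e(1)] by blast
  obtain d2 p2 where best2: "best_approx (odd_trig_polys d2) f2 p2"
    and p2: "\<And>x. \<bar>f2 x - p2 x\<bar> \<le> e"
    using best_odd_trig_approx[OF f2 \<open>odd_fun f2\<close> e(1)] by blast
  have tp: "p1 \<in> trig_polys d1" "p2 \<in> trig_polys d2" and odd: "odd_fun p2"
    using best1 best2 by (auto simp: best_approx_def even_trig_polys_def odd_trig_polys_def)
  have p1_ge: "c \<le> p1 x" for x
    using p1[of x] f1_ge[of x] e(2) by (simp add: c_def abs_le_iff)
  have p_pos: "(p1 x)\<^sup>2 + (p2 x)\<^sup>2 > 0" for x
    using p1_ge[of x] c by (intro add_pos_nonneg) auto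
  define p where "p = (\<lambda>x. complex_of_real (p1 x) + \<i> * complex_of_real (p2 x))"
  define M where "M = (SUP x\<in>{-pi..pi}. sqrt (1 / ((p1 x)\<^sup>2 + (p2 x)\<^sup>2)))"
  \<comment> \<open>At \<open>0\<close> the odd part vanishes, so the supremum is at least \<open>1 / p1 0\<close>.\<close>
  have "1 / K \<le> M"
  proof -
    have "p2 0 = 0" using odd[unfolded odd_fun_def, rule_format, of 0] by simp
    have "0 < p1 0" "p1 0 \<le> K"
      using p1_ge[of 0] c p1[of 0] e(2) by (auto simp: K_def abs_le_iff)
    then have "1 / K \<le> 1 / p1 0" by (intro divide_left_mono) (auto simp: K)
    also have "\<dots> = sqrt (1 / ((p1 0)\<^sup>2 + (p2 0)\<^sup>2))"
      using \<open>p2 0 = 0\<close> \<open>0 < p1 0\<close> by (simp add: real_sqrt_divide)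
    also have "\<dots> \<le> M"
      unfolding M_def
    proof (rule cSUP_upper)
      show "bdd_above ((\<lambda>x. sqrt (1 / ((p1 x)\<^sup>2 + (p2 x)\<^sup>2))) ` {-pi..pi})"
      proof (rule bdd_aboveI2)
        fix x
        have "c\<^sup>2 \<le> (p1 x)\<^sup>2 + (p2 x)\<^sup>2"
          using power_mono[OF p1_ge[of x], of 2] c by (simp add: add_increasing2)
        then have "1 / ((p1 x)\<^sup>2 + (p2 x)\<^sup>2) \<le> 1 / c\<^sup>2"
          using c p_pos[of x] by (intro divide_left_mono) auto
        then show "sqrt (1 / ((p1 x)\<^sup>2 + (p2 x)\<^sup>2)) \<le> sqrt (1 / c\<^sup>2)"
          by (rule real_sqrt_le_mono)
      qed
    qed auto
    finally show ?thesis .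
  qed
  then have "2 * e / c \<le> M * \<epsilon>"
    using e(3) mult_right_mono[of "1 / K" M \<epsilon>] \<open>\<epsilon> > 0\<close> by simp
  have p_cont: "continuous_on {-pi..pi} p"
    unfolding p_def
    by (intro continuous_intros continuous_on_subset[OF continuous_trig_polys[OF tp(1)]]
        continuous_on_subset[OF continuous_trig_polys[OF tp(2)]]) auto
  have f_eq: "f = (\<lambda>x. complex_of_real (f1 x) + \<i> * complex_of_real (f2 x))"
    using assms(10) by blast
  have f_cont: "continuous_on {-pi..pi} f"
    unfolding f_eq
    by (intro continuous_intros continuous_on_subset[OF f1(1)] continuous_on_subset[OF f2(1)]) auto
  have p_Re: "c \<le> Re (p t)" for t using p1_ge[of t] by (simp add: p_def)
  have close: "cmod (f t - p t) \<le> 2 * e" for t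
  proof -
    have "f t - p t = complex_of_real (f1 t - p1 t) + \<i> * complex_of_real (f2 t - p2 t)"
      by (simp add: f_eq p_def algebra_simps)
    then have "cmod (f t - p t) \<le> \<bar>f1 t - p1 t\<bar> + \<bar>f2 t - p2 t\<bar>"
      using norm_triangle_ineq[of "complex_of_real (f1 t - p1 t)" "\<i> * complex_of_real (f2 t - p2 t)"]
      by (simp add: norm_mult flip: of_real_diff)
    then show ?thesis using p1[of t] p2[of t] by linarith
  qed
  have inv: "invertible_mat (toeplitz p n)" for n
  proof -
    obtain B where "B \<in> carrier_mat n n" "toeplitz p n * B = 1\<^sub>m n" "B * toeplitz p n = 1\<^sub>m n"
      by (rule toeplitz_inverse[OF p_cont c p_Re])
    then show ?thesis
      using toeplitz_carrier[of p n]
      by (auto simp: invertible_mat_def inverts_mat_def square_mat.simps intro!: exI[of _ B])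
  qed
  have "outliers (the (mat_inverse (toeplitz p n)) * toeplitz f n) {1 - M * \<epsilon> .. 1 + M * \<epsilon>} \<delta> = 0" for n \<delta>
  proof -
    have "s \<in> {1 - M * \<epsilon> .. 1 + M * \<epsilon>}"
      if "s \<in># singular_values (the (mat_inverse (toeplitz p n)) * toeplitz f n)" for s
      using preconditioned_singular_values[OF p_cont f_cont c p_Re _ close that] e(1)
        \<open>2 * e / c \<le> M * \<epsilon>\<close> by (auto simp: abs_le_iff)
    then have "filter_mset (\<lambda>s. s \<notin> extension \<delta> {1 - M * \<epsilon> .. 1 + M * \<epsilon>})
        (singular_values (the (mat_inverse (toeplitz p n)) * toeplitz f n)) =
        filter_mset (\<lambda>_. False) (singular_values (the (mat_inverse (toeplitz p n)) * toeplitz f n))"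
      by (intro filter_mset_cong refl) (simp add: extension_def)
    then show ?thesis by (simp add: outliers_def)
  qed
  then have "general_cluster (\<lambda>n. the (mat_inverse (toeplitz p n)) * toeplitz f n) {1 - M * \<epsilon> .. 1 + M * \<epsilon>}"
    by (simp add: general_cluster_def)
  with best1 best2 p_pos inv show ?thesis
    unfolding Let_def p_def M_def by blast
qed

end
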